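(* Let $K,N\ge1$, $NK<m$, $\mathbf{\Phi}\in\mathbb{R}^{m\times n}$, let $\mathbf{x}\in\mathbb{R}^n$ be $K$-sparse, and let $\mathbf{y}'=\mathbf{\Phi}\mathbf{x}+\mathbf{e}$ with noise $\mathbf{e}\in\mathbb{R}^m$, $\mathbf{e}\ne0$. Suppose the generalized orthogonal matching pursuit algorithm (gOMP), selecting $N$ atoms per iteration, is applied to input $(\mathbf{y}',\mathbf{\Phi})$ with stopping criterion $k=K$, and let $\mathbf{x}_{\Lambda^K}$ be its estimate after $K$ iterations. If $\delta_{NK+K}<1$ and $$\delta_{NK}<\frac{\sqrt{N}}{\sqrt{K}+2\sqrt{N}},$$ then $\|\mathbf{x}-\mathbf{x}_{\Lambda^K}\|_2<C_{K_1}\|\mathbf{e}\|_2$, where $$C_{K_1}=\frac{(1-\delta_{NK})\left(\sqrt{N}(1+\delta_K)+\sqrt{K(1+\delta_N)(1+\delta_K)}\right)}{\left(\sqrt{N}-(\sqrt{K}+2\sqrt{N})\delta_{NK}\right)\sqrt{1-\delta_{NK+K}}}+\frac{2}{\sqrt{1-\delta_{NK+K}}}.$$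
   Context: A vector is $K$-sparse if it has at most $K$ nonzero entries. For an index set $I\subseteq\{1,\dots,n\}$, $\mathbf{\Phi}_I$ is the submatrix of $\mathbf{\Phi}$ with columns indexed by $I$; $\phi_j$ is the $j$-th column of $\mathbf{\Phi}$. RIP: $\mathbf{\Phi}\in\mathbb{R}^{m\times n}$ satisfies the restricted isometry property of order $L$ if there is $\delta\in(0,1)$ such that for all $I\subseteq\{1,\dots,n\}$ with $|I|\le L$ and all $\mathbf{q}\in\mathbb{R}^{I}$, $(1-\delta)\|\mathbf{q}\|_2^2\le\|\mathbf{\Phi}_I\mathbf{q}\|_2^2\le(1+\delta)\|\mathbf{q}\|_2^2$. The RIP constant $\delta_L$ is the smallest $\delta$ for which these inequalities hold. gOMP algorithm with stopping criterion $k=K$ (input a measurement $\mathbf{v}\in\mathbb{R}^m$ and $\mathbf{\Phi}\in\mathbb{R}^{m\times n}$): set $\mathbf{r}^0=\mathbf{v}$, $\Lambda^0=\emptyset$. For $k=1,\dots,K$: let $h^k$ be a set of $N$ indices $j\in\{1,\dots,n\}$ for which $|\langle \mathbf{r}^{k-1},\phi_j\rangle|$ is largest; put $\Lambda^k=\Lambda^{k-1}\cup h^k$; let $\mathbf{x}_{\Lambda^k}\in\mathbb{R}^n$ be the minimizer of $\|\mathbf{v}-\mathbf{\Phi}\mathbf{z}\|_2$ over $\mathbf{z}\in\mathbb{R}^n$ supported in $\Lambda^k$; put $\mathbf{r}^k=\mathbf{v}-\mathbf{\Phi}\mathbf{x}_{\Lambda^k}$. It is assumed that the matrices $\mathbf{\Phi}_{\Lambda^k}$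 have full column rank.
   Formalization: The case N=K=1 is excluded because the claim is false there: with columns (5/6,0), (1,1/2), x=(1,0), e=(ε,0), all hypotheses hold, but the wrong atom is selected and the error is at least 1 for every ε>0. *)

theory Defs
  imports "HOL-Analysis.Analysis"
begin

section \<open>Sparse vectors and column submatrices\<close>

definition supp :: "real ^ 'n \<Rightarrow> 'n set" where
  "supp x = {j. x $ j \<noteq> 0}"

definition k_sparse :: "nat \<Rightarrow> real ^ 'n \<Rightarrow> bool" where
  "k_sparse K x \<longleftrightarrow> card (supp x) \<le> K"

text \<open>The product of the column submatrix \<open>\<Phi>\<^sub>I\<close> with a vector \<open>q\<close> indexed by \<open>I\<close>. Such a vector is
  represented by a function on the whole index type; its values outside \<open>I\<close> are irrelevant both here
  and in \<open>L2_set q I\<close>, its Euclidean norm.\<close>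

definition submatrix_mult :: "real ^ 'n ^ 'm \<Rightarrow> 'n set \<Rightarrow> ('n \<Rightarrow> real) \<Rightarrow> real ^ 'm" where
  "submatrix_mult \<Phi> I q = (\<Sum>j\<in>I. q j *\<^sub>R column j \<Phi>)"

text \<open>The dimension is that of the column space of \<open>\<Phi>\<^sub>I\<close>, i.e. the rank of \<open>\<Phi>\<^sub>I\<close>.\<close>

definition full_column_rank :: "real ^ 'n ^ 'm \<Rightarrow> 'n set \<Rightarrow> bool" where
  "full_column_rank \<Phi> I \<longleftrightarrow> dim (span ((\<lambda>j. column j \<Phi>) ` I)) = card I"


section \<open>Restricted isometry constants\<close>

definition rip_ineqs :: "real ^ 'n ^ 'm \<Rightarrow> nat \<Rightarrow> real \<Rightarrow> bool" where
  "rip_ineqs \<Phi> L \<delta> \<longleftrightarrow>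
     (\<forall>I q. card I \<le> L \<longrightarrow>
        (1 - \<delta>) * (L2_set q I)\<^sup>2 \<le> (norm (submatrix_mult \<Phi> I q))\<^sup>2 \<and>
        (norm (submatrix_mult \<Phi> I q))\<^sup>2 \<le> (1 + \<delta>) * (L2_set q I)\<^sup>2)"

text \<open>The range of \<open>\<delta>\<close> is not restricted to \<open>(0,1)\<close>: the constant is \<open>0\<close> for orthonormal columns, and
  \<open>rip_const \<Phi> L < 1\<close> expresses that the property of order \<open>L\<close> holds. For \<open>L \<ge> 1\<close> the
  minimum exists (\<open>rip_const_least\<close> below).\<close>

definition rip_const :: "real ^ 'n ^ 'm \<Rightarrow> nat \<Rightarrow> real" where
  "rip_const \<Phi> L = (LEAST \<delta>. rip_ineqs \<Phi> L \<delta>)"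

lemma rip_ineqs_nonneg:
  fixes \<Phi> :: "real ^ 'n ^ 'm"
  assumes "L \<ge> 1" "rip_ineqs \<Phi> L \<delta>"
  shows "\<delta> \<ge> 0"
proof -
  obtain j :: 'n where True by simp
  have "card {j} \<le> L" using assms(1) by simp
  then have "(1 - \<delta>) * (L2_set (\<lambda>_. 1) {j})\<^sup>2 \<le> (1 + \<delta>) * (L2_set (\<lambda>_. 1) {j})\<^sup>2"
    using assms(2) unfolding rip_ineqs_def by (meson order_trans)
  then show ?thesis by simp
qed

lemma submatrix_mult_norm_bound:
  fixes \<Phi> :: "real ^ 'n ^ 'm"
  shows "(norm (submatrix_mult \<Phi> I q))\<^sup>2 \<le> (\<Sum>j\<in>UNIV. norm (column j \<Phi>))\<^sup>2 * (L2_set q I)\<^sup>2"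
proof -
  have fin: "finite I" by simp
  have "norm (submatrix_mult \<Phi> I q) \<le> (\<Sum>j\<in>I. norm (q j *\<^sub>R column j \<Phi>))"
    unfolding submatrix_mult_def by (rule norm_sum)
  also have "\<dots> \<le> (\<Sum>j\<in>I. L2_set q I * norm (column j \<Phi>))"
  proof (rule sum_mono)
    fix j assume "j \<in> I"
    then have "\<bar>q j\<bar> \<le> L2_set q I"
      using member_le_L2_set[OF fin, of j "\<lambda>i. \<bar>q i\<bar>"] by (simp add: L2_set_def)
    then show "norm (q j *\<^sub>R column j \<Phi>) \<le> L2_set q I * norm (column j \<Phi>)"
      by (simp add: mult_right_mono)
  qed
  also have "\<dots> = L2_set q I * (\<Sum>j\<in>I. norm (column j \<Phi>))"
    by (simp add: sum_distrib_left)
  also have "\<dots> \<le> L2_set q I * (\<Sum>j\<in>UNIV. norm (column j \<Phi>))"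
    by (intro mult_left_mono sum_mono2) auto
  finally show ?thesis
    using power_mono[of _ _ 2] by (fastforce simp: power_mult_distrib mult.commute)
qed

lemma rip_const_least:
  fixes \<Phi> :: "real ^ 'n ^ 'm"
  assumes L: "L \<ge> 1"
  shows "rip_ineqs \<Phi> L (rip_const \<Phi> L)"
    and "\<And>\<delta>. rip_ineqs \<Phi> L \<delta> \<Longrightarrow> rip_const \<Phi> L \<le> \<delta>"
proof -
  define S where "S = Collect (rip_ineqs \<Phi> L)"
  define B where "B = (\<Sum>j\<in>UNIV. norm (column j \<Phi>))\<^sup>2"
  have B: "B \<ge> 0" by (simp add: B_def)
  have "rip_ineqs \<Phi> L (1 + B)"
    unfolding rip_ineqs_def
  proof (intro allI impI conjI)
    fix I :: "'n set" and q :: "'n \<Rightarrow> real"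
    have "(1 - (1 + B)) * (L2_set q I)\<^sup>2 \<le> 0" using B by simp
    also have "0 \<le> (norm (submatrix_mult \<Phi> I q))\<^sup>2" by simp
    finally show "(1 - (1 + B)) * (L2_set q I)\<^sup>2 \<le> (norm (submatrix_mult \<Phi> I q))\<^sup>2" .
    have "(norm (submatrix_mult \<Phi> I q))\<^sup>2 \<le> B * (L2_set q I)\<^sup>2"
      unfolding B_def by (rule submatrix_mult_norm_bound)
    also have "\<dots> \<le> (1 + (1 + B)) * (L2_set q I)\<^sup>2" by (intro mult_right_mono) auto
    finally show "(norm (submatrix_mult \<Phi> I q))\<^sup>2 \<le> (1 + (1 + B)) * (L2_set q I)\<^sup>2" .
  qed
  then have ne: "S \<noteq> {}" by (auto simp: S_def)
  have bdd: "bdd_below S"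
    unfolding S_def using rip_ineqs_nonneg[OF L] by (intro bdd_belowI[of _ 0]) simp
  have "closed S"
    unfolding S_def rip_ineqs_def
    by (intro closed_Collect_all closed_Collect_imp closed_Collect_conj closed_Collect_le
        open_Collect_const continuous_intros)
  then have mem: "Inf S \<in> S" by (rule closed_contains_Inf[OF ne bdd])
  have low: "Inf S \<le> \<delta>" if "rip_ineqs \<Phi> L \<delta>" for \<delta>
    using that bdd by (auto simp: S_def intro: cInf_lower)
  have eq: "rip_const \<Phi> L = Inf S"
    unfolding rip_const_def using mem low by (intro Least_equality) (auto simp: S_def)
  show "rip_ineqs \<Phi> L (rip_const \<Phi> L)" using mem by (simp add: eq S_def)
  show "\<And>\<delta>. rip_ineqs \<Phi> L \<delta> \<Longrightarrow> rip_const \<Phi> L \<le> \<delta>" using low by (simp add: eq)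
qed


section \<open>Generalized orthogonal matching pursuit\<close>

text \<open>A run of \<open>K\<close> iterations on the input \<open>(v, \<Phi>)\<close>, with \<open>N\<close> atoms selected in each; \<open>X k\<close> is the
  estimate after iteration \<open>k\<close>. This is a relation, since ties in the selection may be broken arbitrarily.
  The values of \<open>h\<close> and \<open>X\<close> at \<open>0\<close>, and of all sequences beyond \<open>K\<close>, are not constrained.\<close>

definition gomp_run ::
  "real ^ 'n ^ 'm \<Rightarrow> real ^ 'm \<Rightarrow> nat \<Rightarrow> nat \<Rightarrow>
   (nat \<Rightarrow> 'n set) \<Rightarrow> (nat \<Rightarrow> 'n set) \<Rightarrow> (nat \<Rightarrow> real ^ 'n) \<Rightarrow> (nat \<Rightarrow> real ^ 'm) \<Rightarrow> bool" where
  "gomp_run \<Phi> v N K h \<Lambda> X r \<longleftrightarrow>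
     r 0 = v \<and> \<Lambda> 0 = {} \<and>
     (\<forall>k\<in>{1..K}.
        card (h k) = N \<and>
        (\<forall>i\<in>h k. \<forall>j. j \<notin> h k \<longrightarrow> \<bar>r (k - 1) \<bullet> column j \<Phi>\<bar> \<le> \<bar>r (k - 1) \<bullet> column i \<Phi>\<bar>) \<and>
        \<Lambda> k = \<Lambda> (k - 1) \<union> h k \<and>
        is_arg_min (\<lambda>z. norm (v - \<Phi> *v z)) (\<lambda>z. supp z \<subseteq> \<Lambda> k) (X k) \<and>
        r k = v - \<Phi> *v X k)"

definition gomp_error_const :: "real ^ 'n ^ 'm \<Rightarrow> nat \<Rightarrow> nat \<Rightarrow> real" where
  "gomp_error_const \<Phi> N K =
     (1 - rip_const \<Phi> (N * K)) *
       (sqrt N * (1 + rip_const \<Phi> K) + sqrt (K * (1 + rip_const \<Phi> N) * (1 + rip_const \<Phi> K))) /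
       ((sqrt N - (sqrt K + 2 * sqrt N) * rip_const \<Phi> (N * K)) * sqrt (1 - rip_const \<Phi> (N * K + K)))
     + 2 / sqrt (1 - rip_const \<Phi> (N * K + K))"


section \<open>The case \<open>N = K = 1\<close>\<close>

text \<open>For \<open>N = K = 1\<close> the hypothesis \<open>rip_const \<Phi> 1 < 1/3\<close> constrains only the norms of the columns, so
  that the first selection can be wrong however small the noise is, and the error bound
  fails. This is why this case has to be excluded from the recovery theorem.\<close>

lemma column_norms_two:
  fixes \<Phi> :: "real ^ 2 ^ 2"
  assumes \<Phi>: "\<Phi> = vector [vector [5/6, 1], vector [0, 1/2]]"
  shows "column 1 \<Phi> = vector [5/6, 0]" "column 2 \<Phi> = vector [1, 1/2]"
  by (simp_all add: \<Phi> column_def vec_eq_iff forall_2)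

lemma gomp_error_bound_fails_1_1:
  "\<exists>(\<Phi> :: real ^ 2 ^ 2) (x :: real ^ 2) (e :: real ^ 2) h \<Lambda> X r.
     k_sparse 1 x \<and> e \<noteq> 0 \<and>
     gomp_run \<Phi> (\<Phi> *v x + e) 1 1 h \<Lambda> X r \<and>
     (\<forall>k\<in>{1..1}. full_column_rank \<Phi> (\<Lambda> k)) \<and>
     rip_const \<Phi> (1 * 1 + 1) < 1 \<and>
     rip_const \<Phi> (1 * 1) < sqrt (real 1) / (sqrt (real 1) + 2 * sqrt (real 1)) \<and>
     \<not> norm (x - X 1) < gomp_error_const \<Phi> 1 1 * norm e"
proof -
  define \<Phi> :: "real ^ 2 ^ 2" where "\<Phi> = vector [vector [5/6, 1], vector [0, 1/2]]"
  define C where "C = gomp_error_const \<Phi> 1 1"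
  define \<epsilon> where "\<epsilon> = 1 / (1 + \<bar>C\<bar>)"
  define x :: "real ^ 2" where "x = vector [1, 0]"
  define e :: "real ^ 2" where "e = vector [\<epsilon>, 0]"
  define v where "v = \<Phi> *v x + e"
  define t where "t = (5/6 + \<epsilon>) * 4/5"
  define X where "X = (\<lambda>k::nat. vector [0, t] :: real ^ 2)"
  define h where "h = (\<lambda>k::nat. {2::2})"
  define \<Lambda> where "\<Lambda> = (\<lambda>k::nat. if k = 0 then {} else {2::2})"
  define r where "r = (\<lambda>k::nat. if k = 0 then v else v - \<Phi> *v X k)"
  note col = column_norms_two[OF \<Phi>_def]
  have \<epsilon>: "\<epsilon> > 0" by (simp add: \<epsilon>_def add_pos_nonneg)
  have v: "v $ 1 = 5/6 + \<epsilon>" "v $ 2 = 0"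
    by (simp_all add: v_def e_def x_def \<Phi>_def matrix_vector_mult_def sum_2)
  have nsq: "(norm y)\<^sup>2 = (y $ 1)\<^sup>2 + (y $ 2)\<^sup>2" for y :: "real ^ 2"
    unfolding power2_norm_eq_inner by (simp add: inner_vec_def sum_2 power2_eq_square)
  have sets: "I = {} \<or> I = {1} \<or> I = {2} \<or> I = {1, 2}" for I :: "2 set"
  proof -
    have "I \<subseteq> {1, 2}" using exhaust_2 by auto
    then show ?thesis by auto
  qed
  have rip1: "rip_ineqs \<Phi> 1 (31/100)"
    unfolding rip_ineqs_def
  proof (intro allI impI)
    fix I :: "2 set" and q :: "2 \<Rightarrow> real"
    assume "card I \<le> 1"
    then consider "I = {}" | "I = {1}" | "I = {2}" using sets[of I] by fastforce
    then show "(1 - 31/100) * (L2_set q I)\<^sup>2 \<le> (norm (submatrix_mult \<Phi> I q))\<^sup>2 \<and>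
        (norm (submatrix_mult \<Phi> I q))\<^sup>2 \<le> (1 + 31/100) * (L2_set q I)\<^sup>2"
      unfolding submatrix_mult_def nsq
      by cases (simp_all add: col power2_eq_square)
  qed
  have rip2: "rip_ineqs \<Phi> 2 (95/100)"
    unfolding rip_ineqs_def
  proof (intro allI impI)
    fix I :: "2 set" and q :: "2 \<Rightarrow> real"
    have *: "(1 - 95/100) * (a\<^sup>2 + b\<^sup>2) \<le> (5/6 * a + b)\<^sup>2 + (b / 2)\<^sup>2 \<and>
        (5/6 * a + b)\<^sup>2 + (b / 2)\<^sup>2 \<le> (1 + 95/100) * (a\<^sup>2 + b\<^sup>2)" for a b :: real
    proof -
      have "0 \<le> (5/6 * a + 6/5 * b)\<^sup>2 * (5/6) + (116/180 - 125/216) * a\<^sup>2"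
        by (intro add_nonneg_nonneg mult_nonneg_nonneg) auto
      moreover have "0 \<le> (5/6 * a - 7/10 * b)\<^sup>2 * (10/7) + (226/180 - 250/252) * a\<^sup>2"
        by (intro add_nonneg_nonneg mult_nonneg_nonneg) auto
      ultimately show ?thesis by (simp add: power2_eq_square field_simps)
    qed
    have ne: "(1::2) \<noteq> 2" by simp
    have I: "L2_set q I ^ 2 = (if 1 \<in> I then q 1 else 0)\<^sup>2 + (if 2 \<in> I then q 2 else 0)\<^sup>2"
      using sets[of I] ne by (auto simp: L2_set_def)
    have S: "submatrix_mult \<Phi> I q = (if 1 \<in> I then q 1 else 0) *\<^sub>R column 1 \<Phi>
        + (if 2 \<in> I then q 2 else 0) *\<^sub>R column 2 \<Phi>"
      using sets[of I] ne by (auto simp: submatrix_mult_def)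
    show "(1 - 95/100) * (L2_set q I)\<^sup>2 \<le> (norm (submatrix_mult \<Phi> I q))\<^sup>2 \<and>
        (norm (submatrix_mult \<Phi> I q))\<^sup>2 \<le> (1 + 95/100) * (L2_set q I)\<^sup>2"
      using *[of "if 1 \<in> I then q 1 else 0" "if 2 \<in> I then q 2 else 0"]
      unfolding I S nsq by (simp add: col mult.commute)
  qed
  have c: "rip_const \<Phi> 1 \<le> 31/100" "rip_const \<Phi> 2 \<le> 95/100"
    using rip_const_least(2)[OF _ rip1] rip_const_least(2)[OF _ rip2] by simp_all
  have rip: "rip_const \<Phi> (1 * 1 + 1) < 1"
    "rip_const \<Phi> (1 * 1) < sqrt (real 1) / (sqrt (real 1) + 2 * sqrt (real 1))"
    using c by (simp_all add: numeral_2_eq_2)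
  have sp: "k_sparse 1 x"
  proof -
    have "supp x = {1}" unfolding supp_def x_def using exhaust_2 by (auto; metis vector_2)
    then show ?thesis by (simp add: k_sparse_def)
  qed
  have ne: "e \<noteq> 0" using \<epsilon> by (simp add: e_def vec_eq_iff forall_2)
  have min: "norm (v - \<Phi> *v vector [0, t]) \<le> norm (v - \<Phi> *v z)" if "supp z \<subseteq> {2}" for z
  proof -
    have z1: "z $ 1 = 0" using that by (auto simp: supp_def)
    have "(norm (v - \<Phi> *v z))\<^sup>2 - (norm (v - \<Phi> *v vector [0, t]))\<^sup>2 = 5/4 * (z $ 2 - t)\<^sup>2"
      unfolding nsq
      by (simp add: v z1 \<Phi>_def matrix_vector_mult_def sum_2 t_def power2_eq_square field_simps)
    then have "(norm (v - \<Phi> *v vector [0, t]))\<^sup>2 \<le> (norm (v - \<Phi> *v z))\<^sup>2"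
      using zero_le_power2[of "z $ 2 - t"] by linarith
    then show ?thesis by (rule power2_le_imp_le) simp
  qed
  have sX: "supp (vector [0, t] :: real ^ 2) \<subseteq> {2}"
  proof
    fix j :: 2
    assume "j \<in> supp (vector [0, t] :: real ^ 2)"
    then show "j \<in> {2}" using exhaust_2[of j] by (auto simp: supp_def)
  qed
  have sel: "\<bar>v \<bullet> column j \<Phi>\<bar> \<le> \<bar>v \<bullet> column 2 \<Phi>\<bar>" if "j \<noteq> 2" for j
  proof -
    have "j = 1" using that exhaust_2 by blast
    then show ?thesis using \<epsilon> by (simp add: inner_vec_def sum_2 col v)
  qed
  have run: "gomp_run \<Phi> v 1 1 h \<Lambda> X r"
    unfolding gomp_run_def is_arg_min_linorder
    using min sX sel by (simp add: h_def \<Lambda>_def X_def r_def)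
  have "column 2 \<Phi> \<noteq> 0" by (simp add: col vec_eq_iff forall_2)
  then have "full_column_rank \<Phi> {2}" by (simp add: full_column_rank_def dim_insert)
  then have rk: "\<forall>k\<in>{1..1}. full_column_rank \<Phi> (\<Lambda> k)" by (simp add: \<Lambda>_def)
  have "\<bar>(x - X 1) $ 1\<bar> \<le> norm (x - X 1)" by (rule component_le_norm_cart)
  then have "1 \<le> norm (x - X 1)" by (simp add: x_def X_def)
  moreover have "C * norm e \<le> 1"
  proof -
    have "(norm e)\<^sup>2 = \<epsilon>\<^sup>2" by (simp add: nsq e_def)
    then have "norm e = \<epsilon>" using \<epsilon> by (simp add: power2_eq_iff_nonneg)
    moreover have "C \<le> 1 + \<bar>C\<bar>" "1 + \<bar>C\<bar> > 0" by linarith+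
    ultimately show ?thesis by (simp add: \<epsilon>_def)
  qed
  ultimately have "\<not> norm (x - X 1) < gomp_error_const \<Phi> 1 1 * norm e"
    unfolding C_def[symmetric] by linarith
  then show ?thesis using sp ne run rk rip unfolding v_def by blast
qed

end

theory Submission
  imports Defs
begin

text \<open>Call an iteration failed if it selects no new index of the support \<open>T\<close> of \<open>x\<close> although \<open>T\<close> is not
  yet covered. If no iteration fails, \<open>T\<close> is covered after \<open>K\<close> iterations and the last residual is at most
  \<open>\<parallel>e\<parallel>\<close>. Otherwise let \<open>r\<close> be the residual at the first failure, \<open>w\<close> the part of \<open>x\<close> outside the current
  index set, and \<open>\<beta>\<close> the largest correlation of \<open>r\<close> with a column of \<open>supp w\<close>. Failure makes all
  \<open>N\<close> selected correlations at least \<open>\<beta>\<close>; this bounds \<open>\<beta>\<close> by near-orthogonality of disjoint columns, while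
  \<open>\<parallel>w\<parallel>\<close> is bounded in terms of \<open>\<beta>\<close> and the noise, so \<open>\<parallel>w\<parallel>\<close> is at most a multiple of \<open>\<parallel>e\<parallel>\<close>. Finally
  \<open>\<parallel>r\<parallel>\<^sup>2 = \<langle>\<Phi> w, r\<rangle> + \<langle>e, r\<rangle> \<le> \<surd>K \<beta> \<parallel>w\<parallel> + \<parallel>r\<parallel> \<parallel>e\<parallel>\<close> bounds \<open>\<parallel>r\<parallel>\<close>, and residuals do not increase later on.

  The restricted isometry constant of order \<open>N K\<close> controls every pair of supports that occurs, except in
  the first iteration if \<open>N = 1\<close> or \<open>K = 1\<close>, where \<open>N + K = N K + 1\<close>. There one vector has a single
  entry; averaging over the deletions of one entry of the other vector costs a factor
  \<open>\<surd>(M / (M - 1))\<close> with \<open>M = N K\<close>, which the slack of the residual estimate absorbs.\<close>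

section \<open>Restricted isometry estimates for sparse vectors\<close>

definition restrict_vec :: "real ^ 'n \<Rightarrow> 'n set \<Rightarrow> real ^ 'n" where
  "restrict_vec x S = (\<chi> i. if i \<in> S then x $ i else 0)"

lemma restrict_vec_nth [simp]: "restrict_vec x S $ i = (if i \<in> S then x $ i else 0)"
  by (simp add: restrict_vec_def)

lemma supp_restrict_vec: "supp (restrict_vec x S) = supp x \<inter> S"
  by (auto simp: supp_def)

lemma supp_add: "supp (x + y) \<subseteq> supp x \<union> supp y"
  by (auto simp: supp_def)

lemma supp_diff: "supp (x - y) \<subseteq> supp x \<union> supp y"
  by (auto simp: supp_def)

lemma supp_scaleR: "supp (c *\<^sub>R x) \<subseteq> supp x"
  by (auto simp: supp_def)

lemma inner_disjoint_supp:
  fixes x y :: "real ^ 'n"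
  assumes "supp x \<inter> supp y = {}"
  shows "x \<bullet> y = 0"
proof -
  have "x $ i * y $ i = 0" for i using assms by (auto simp: supp_def)
  then show ?thesis unfolding inner_vec_def by (intro sum.neutral) simp
qed

lemma norm_disjoint_supp:
  fixes x y :: "real ^ 'n"
  assumes "supp x \<inter> supp y = {}"
  shows "(norm (x + y))\<^sup>2 = (norm x)\<^sup>2 + (norm y)\<^sup>2"
    and "(norm (x - y))\<^sup>2 = (norm x)\<^sup>2 + (norm y)\<^sup>2"
  using inner_disjoint_supp[OF assms]
  by (simp_all add: power2_norm_eq_inner inner_add_left inner_add_right inner_diff_left
      inner_diff_right inner_commute)

lemma inner_matrix_vector_mult:
  fixes \<Phi> :: "real ^ 'n ^ 'm"
  shows "(\<Phi> *v a) \<bullet> r = (\<Sum>i\<in>UNIV. a $ i * (r \<bullet> column i \<Phi>))"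
  by (simp add: matrix_mult_sum inner_sum_left scalar_mult_eq_scaleR inner_commute[of r])

lemma submatrix_mult_nth:
  fixes \<Phi> :: "real ^ 'n ^ 'm"
  assumes "supp x \<subseteq> I"
  shows "submatrix_mult \<Phi> I (($) x) = \<Phi> *v x" and "L2_set (($) x) I = norm x"
proof -
  have "(\<Sum>j\<in>I. x $ j *\<^sub>R column j \<Phi>) = (\<Sum>j\<in>UNIV. x $ j *\<^sub>R column j \<Phi>)"
    using assms by (intro sum.mono_neutral_left) (auto simp: supp_def)
  then show "submatrix_mult \<Phi> I (($) x) = \<Phi> *v x"
    by (simp add: submatrix_mult_def matrix_mult_sum scalar_mult_eq_scaleR)
  have "(\<Sum>j\<in>I. (x $ j)\<^sup>2) = (\<Sum>j\<in>UNIV. (x $ j)\<^sup>2)"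
    using assms by (intro sum.mono_neutral_left) (auto simp: supp_def)
  then show "L2_set (($) x) I = norm x"
    by (simp add: L2_set_def norm_vec_def)
qed

lemma rip_const_bounds:
  fixes \<Phi> :: "real ^ 'n ^ 'm"
  assumes "1 \<le> L" "card (supp x) \<le> L"
  shows "(1 - rip_const \<Phi> L) * (norm x)\<^sup>2 \<le> (norm (\<Phi> *v x))\<^sup>2"
    and "(norm (\<Phi> *v x))\<^sup>2 \<le> (1 + rip_const \<Phi> L) * (norm x)\<^sup>2"
proof -
  have "rip_ineqs \<Phi> L (rip_const \<Phi> L)" by (rule rip_const_least(1)[OF assms(1)])
  note this[unfolded rip_ineqs_def, rule_format, OF assms(2), of "($) x",
      unfolded submatrix_mult_nth[OF subset_refl]]
  then show "(1 - rip_const \<Phi> L) * (norm x)\<^sup>2 \<le> (norm (\<Phi> *v x))\<^sup>2"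
    and "(norm (\<Phi> *v x))\<^sup>2 \<le> (1 + rip_const \<Phi> L) * (norm x)\<^sup>2"
    by blast+
qed

lemma rip_const_nonneg: "1 \<le> L \<Longrightarrow> 0 \<le> rip_const \<Phi> L"
  by (rule rip_ineqs_nonneg[OF _ rip_const_least(1)])

lemma rip_const_mono:
  assumes "1 \<le> L" "L \<le> L'"
  shows "rip_const \<Phi> L \<le> rip_const \<Phi> L'"
proof (rule rip_const_least(2)[OF assms(1)])
  have "rip_ineqs \<Phi> L' (rip_const \<Phi> L')" using assms by (intro rip_const_least(1)) simp
  then show "rip_ineqs \<Phi> L (rip_const \<Phi> L')"
    using assms(2) order_trans[OF _ assms(2)] unfolding rip_ineqs_def by blast
qed

lemma norm_mult_le_sqrt_rip_const:
  fixes \<Phi> :: "real ^ 'n ^ 'm"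
  assumes "1 \<le> L" "card (supp x) \<le> L"
  shows "norm (\<Phi> *v x) \<le> sqrt (1 + rip_const \<Phi> L) * norm x"
proof (rule power2_le_imp_le)
  show "(norm (\<Phi> *v x))\<^sup>2 \<le> (sqrt (1 + rip_const \<Phi> L) * norm x)\<^sup>2"
    using rip_const_bounds(2)[OF assms, of \<Phi>] rip_const_nonneg[OF assms(1), of \<Phi>]
    by (simp add: power_mult_distrib)
qed (use rip_const_nonneg[OF assms(1), of \<Phi>] in simp)

lemma rip_inner_disjoint:
  fixes \<Phi> :: "real ^ 'n ^ 'm"
  assumes L: "1 \<le> L" and disj: "supp a \<inter> supp b = {}"
    and card: "card (supp a \<union> supp b) \<le> L"
  shows "\<bar>(\<Phi> *v a) \<bullet> (\<Phi> *v b)\<bar> \<le> rip_const \<Phi> L * norm a * norm b"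
proof (cases "a = 0 \<or> b = 0")
  case True
  then show ?thesis by auto
next
  case False
  define \<delta> where "\<delta> = rip_const \<Phi> L"
  have polar: "2 * \<bar>(\<Phi> *v c) \<bullet> (\<Phi> *v d)\<bar> \<le> \<delta> * ((norm c)\<^sup>2 + (norm d)\<^sup>2)"
    if "supp c \<subseteq> supp a" "supp d \<subseteq> supp b" for c d
  proof -
    have cd: "supp c \<inter> supp d = {}" using that disj by blast
    have "card (supp (c + d)) \<le> L" "card (supp (c - d)) \<le> L"
      using that supp_add[of c d] supp_diff[of c d]
      by (auto intro!: order_trans[OF card_mono card])
    note P = rip_const_bounds[OF L this(1), of \<Phi>] and M = rip_const_bounds[OF L this(2), of \<Phi>]
    have "4 * ((\<Phi> *v c) \<bullet> (\<Phi> *v d)) = (norm (\<Phi> *v (c + d)))\<^sup>2 - (norm (\<Phi> *v (c - d)))\<^sup>2"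
      by (simp add: matrix_vector_right_distrib matrix_vector_mult_diff_distrib
          power2_norm_eq_inner inner_add_left inner_add_right inner_diff_left inner_diff_right
          inner_commute)
    with P M show ?thesis
      by (simp add: norm_disjoint_supp[OF cd] \<delta>_def abs_le_iff algebra_simps)
  qed
  define c d where "c = (1 / norm a) *\<^sub>R a" and "d = (1 / norm b) *\<^sub>R b"
  have "norm c = 1" "norm d = 1" using False by (simp_all add: c_def d_def)
  then have "\<bar>(\<Phi> *v c) \<bullet> (\<Phi> *v d)\<bar> \<le> \<delta>"
    using polar[of c d] supp_scaleR unfolding c_def d_def by fastforce
  then have "norm a * norm b * \<bar>(\<Phi> *v c) \<bullet> (\<Phi> *v d)\<bar> \<le> norm a * norm b * \<delta>"
    by (intro mult_left_mono) auto
  moreover have "(\<Phi> *v a) \<bullet> (\<Phi> *v b) = norm a * norm b * ((\<Phi> *v c) \<bullet> (\<Phi> *v d))"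
    using False by (simp add: c_def d_def matrix_vector_mult_scaleR)
  ultimately have "\<bar>(\<Phi> *v a) \<bullet> (\<Phi> *v b)\<bar> \<le> norm a * norm b * \<delta>"
    by (simp add: abs_mult)
  then show ?thesis by (simp add: \<delta>_def mult_ac)
qed

lemma rip_inner_single:
  fixes \<Phi> :: "real ^ 'n ^ 'm"
  assumes L: "2 \<le> L" and a: "card (supp a) \<le> 1" and b: "card (supp b) \<le> L"
    and disj: "supp a \<inter> supp b = {}"
  shows "\<bar>(\<Phi> *v a) \<bullet> (\<Phi> *v b)\<bar> \<le> sqrt (real L / (real L - 1)) * rip_const \<Phi> L * norm a * norm b"
proof (cases "a = 0")
  case True
  then show ?thesis by simp
next
  case False
  define \<delta> where "\<delta> = rip_const \<Phi> L"
  have \<delta>: "0 \<le> \<delta>" using L by (simp add: \<delta>_def rip_const_nonneg)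
  define d where "d = (\<chi> j. column j \<Phi> \<bullet> (\<Phi> *v a))"
  have inner_d: "(\<Phi> *v c) \<bullet> (\<Phi> *v a) = c \<bullet> d" for c
    unfolding inner_matrix_vector_mult[of \<Phi> c] inner_vec_def[of c d]
    by (simp add: d_def inner_commute)
  have sa: "card (supp a) = 1"
  proof -
    have "supp a \<noteq> {}" using False by (auto simp: supp_def vec_eq_iff)
    then show ?thesis using a by (simp add: card_eq_0_iff le_Suc_eq)
  qed
  define D where "D S = (\<Sum>j\<in>S. (d $ j)\<^sup>2)" for S
  have restr: "restrict_vec d S \<bullet> d = D S" for S
    by (simp add: D_def inner_vec_def power2_eq_square if_distrib if_distribR sum.If_cases
        cong: if_cong)
  have norm_restr: "(norm (restrict_vec d S))\<^sup>2 = D S" for S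
    unfolding power2_norm_eq_inner
    by (simp add: D_def inner_vec_def power2_eq_square if_distrib if_distribR sum.If_cases
        cong: if_cong)
  have small: "D S \<le> (\<delta> * norm a)\<^sup>2" if S: "S \<subseteq> supp b" "card S \<le> L - 1" for S
  proof -
    let ?c = "restrict_vec d S"
    have "card (supp ?c) \<le> card S" by (intro card_mono) (auto simp: supp_restrict_vec)
    then have "card (supp ?c \<union> supp a) \<le> L"
      using card_Un_le[of "supp ?c" "supp a"] S(2) L sa by linarith
    moreover have "supp ?c \<inter> supp a = {}" using S disj by (auto simp: supp_restrict_vec)
    ultimately have "\<bar>(\<Phi> *v ?c) \<bullet> (\<Phi> *v a)\<bar> \<le> \<delta> * norm ?c * norm a"
      using L unfolding \<delta>_def by (intro rip_inner_disjoint) auto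
    then have "(norm ?c)\<^sup>2 \<le> \<delta> * norm ?c * norm a" by (simp add: inner_d restr norm_restr)
    then have "norm ?c * norm ?c \<le> norm ?c * (\<delta> * norm a)" by (simp add: power2_eq_square mult_ac)
    then have "norm ?c \<le> \<delta> * norm a" using \<delta> by (cases "norm ?c = 0") auto
    then have "(norm ?c)\<^sup>2 \<le> (\<delta> * norm a)\<^sup>2" by (intro power_mono) auto
    then show ?thesis by (simp add: norm_restr)
  qed
  have D: "(real L - 1) * D (supp b) \<le> real L * (\<delta> * norm a)\<^sup>2"
  proof (cases "card (supp b) = L")
    case True
    have "D (supp b) - (d $ j)\<^sup>2 \<le> (\<delta> * norm a)\<^sup>2" if "j \<in> supp b" for j
    proof -
      have "D (supp b) = (d $ j)\<^sup>2 + D (supp b - {j})"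
        unfolding D_def using that by (intro sum.remove) auto
      moreover have "D (supp b - {j}) \<le> (\<delta> * norm a)\<^sup>2"
        using that True by (intro small) auto
      ultimately show ?thesis by simp
    qed
    then have "(\<Sum>j\<in>supp b. D (supp b) - (d $ j)\<^sup>2) \<le> (\<Sum>j\<in>supp b. (\<delta> * norm a)\<^sup>2)"
      by (rule sum_mono)
    then show ?thesis by (simp add: sum_subtractf True D_def[symmetric] algebra_simps)
  next
    case False
    then have "D (supp b) \<le> (\<delta> * norm a)\<^sup>2" using b by (intro small) auto
    moreover have "0 \<le> D (supp b)" by (simp add: D_def sum_nonneg)
    ultimately show ?thesis using L by (intro mult_mono) auto
  qed
  have "\<bar>b \<bullet> d\<bar> = \<bar>b \<bullet> restrict_vec d (supp b)\<bar>"
    by (auto simp: inner_vec_def supp_def intro!: arg_cong[of _ _ abs] sum.cong)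
  also have "\<dots> \<le> norm b * norm (restrict_vec d (supp b))" by (rule Cauchy_Schwarz_ineq2)
  also have "\<dots> \<le> norm b * (sqrt (real L / (real L - 1)) * (\<delta> * norm a))"
  proof (intro mult_left_mono norm_ge_zero)
    show "norm (restrict_vec d (supp b)) \<le> sqrt (real L / (real L - 1)) * (\<delta> * norm a)"
  proof (rule power2_le_imp_le)
    have "D (supp b) \<le> real L / (real L - 1) * (\<delta> * norm a)\<^sup>2" using D L by (simp add: field_simps)
    then show "(norm (restrict_vec d (supp b)))\<^sup>2 \<le> (sqrt (real L / (real L - 1)) * (\<delta> * norm a))\<^sup>2"
      using L by (simp add: norm_restr power_mult_distrib)
    qed (use \<delta> L in simp)
  qed
  finally show ?thesis
    using inner_d[of b] by (simp add: inner_commute \<delta>_def mult_ac)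
qed

section \<open>Inequalities at a failed iteration\<close>

lemma failed_selection_inequalities:
  fixes \<Phi> :: "real ^ 'n ^ 'm" and x y :: "real ^ 'n" and e r :: "real ^ 'm"
  assumes N: "1 \<le> N" and K: "1 \<le> K" and x: "card (supp x) \<le> K"
    and w: "w = restrict_vec x (- \<Lambda>)"
    and r: "r = \<Phi> *v x + e - \<Phi> *v y" "supp y \<subseteq> \<Lambda>"
    and orth: "\<And>j. j \<in> \<Lambda> \<Longrightarrow> r \<bullet> column j \<Phi> = 0"
    and h: "card h = N" "h \<inter> supp w = {}" "supp w \<noteq> {}"
    and sel: "\<And>i j. i \<in> h \<Longrightarrow> j \<notin> h \<Longrightarrow> \<bar>r \<bullet> column j \<Phi>\<bar> \<le> \<bar>r \<bullet> column i \<Phi>\<bar>"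
    and g: "0 \<le> g"
    and lower: "\<And>z. supp z \<subseteq> \<Lambda> \<Longrightarrow> l * (norm w)\<^sup>2 \<le> (norm (\<Phi> *v (w - z)))\<^sup>2"
    and cross: "\<And>a z. supp a \<subseteq> h - \<Lambda> \<Longrightarrow> supp z \<subseteq> \<Lambda> \<Longrightarrow> (\<Phi> *v z) \<bullet> (\<Phi> *v (w - z)) = 0 \<Longrightarrow>
        \<bar>(\<Phi> *v a) \<bullet> (\<Phi> *v (w - z))\<bar> \<le> g * norm a * norm w"
  obtains \<beta> where "sqrt N * \<beta> \<le> g * norm w + sqrt (1 + rip_const \<Phi> N) * norm e"
    and "l * norm w \<le> sqrt K * \<beta> + sqrt (1 + rip_const \<Phi> K) * norm e"
    and "(norm r)\<^sup>2 \<le> sqrt K * \<beta> * norm w + norm r * norm e"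
proof -
  define V where "V = (\<lambda>z. \<Phi> *v z) ` {z. supp z \<subseteq> \<Lambda>}"
  have "subspace {z::real^'n. supp z \<subseteq> \<Lambda>}"
    by (simp add: subspace_def supp_def subset_iff) (metis add.right_neutral)
  then have V: "subspace V"
    unfolding V_def by (intro linear_subspace_image) auto
  have memV: "\<Phi> *v z \<in> V" if "supp z \<subseteq> \<Lambda>" for z using that by (auto simp: V_def)
  have rV: "r \<bullet> v = 0" if v: "v \<in> V" for v
  proof -
    obtain z where z: "v = \<Phi> *v z" "supp z \<subseteq> \<Lambda>" using v by (auto simp: V_def)
    have "z $ i * (r \<bullet> column i \<Phi>) = 0" for i using z(2) orth[of i] by (auto simp: supp_def)
    then have "(\<Phi> *v z) \<bullet> r = 0" unfolding inner_matrix_vector_mult by (intro sum.neutral) simp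
    then show ?thesis by (simp add: z inner_commute)
  qed
  obtain v1 b where v1: "v1 \<in> V" and bV: "\<And>v. v \<in> V \<Longrightarrow> b \<bullet> v = 0" and wb: "\<Phi> *v w = v1 + b"
    using orthogonal_subspace_decomp_exists[of V "\<Phi> *v w"] span_eq_iff[THEN iffD2, OF V]
    by (metis orthogonal_def)
  obtain e1 e2 where e1: "e1 \<in> V" and eV: "\<And>v. v \<in> V \<Longrightarrow> e2 \<bullet> v = 0" and e: "e = e1 + e2"
    using orthogonal_subspace_decomp_exists[of V e] span_eq_iff[THEN iffD2, OF V]
    by (metis orthogonal_def)
  obtain z where z: "v1 = \<Phi> *v z" "supp z \<subseteq> \<Lambda>" using v1 by (auto simp: V_def)
  have bz: "b = \<Phi> *v (w - z)" using wb z by (simp add: matrix_vector_mult_diff_distrib)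
  have "r - (b + e2) = \<Phi> *v (x - w) + v1 + e1 - \<Phi> *v y"
    using wb by (simp add: r(1) e matrix_vector_mult_diff_distrib algebra_simps)
  also have "\<dots> \<in> V"
  proof -
    have "supp (x - w) \<subseteq> \<Lambda>" by (auto simp: w supp_def)
    then show ?thesis
      using v1 e1 memV[of "x - w"] memV[OF r(2)] V by (intro subspace_add subspace_diff) auto
  qed
  finally have d: "r - (b + e2) \<in> V" .
  have "(r - (b + e2)) \<bullet> (r - (b + e2)) = 0"
    using rV[OF d] bV[OF d] eV[OF d] by (simp add: inner_diff_left inner_add_left)
  then have rb: "r = b + e2" by simp
  have vr: "v1 \<bullet> r = 0" and er: "e1 \<bullet> r = 0"
    using rV[OF v1] rV[OF e1] by (simp_all add: inner_commute)
  have rw: "r \<bullet> r = (\<Phi> *v w) \<bullet> r + e \<bullet> r"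
    using arg_cong[OF rb, of "\<lambda>u. u \<bullet> r"] vr er unfolding wb e by (simp add: inner_add_left)
  have wr: "(\<Phi> *v w) \<bullet> r = (norm b)\<^sup>2 + b \<bullet> e2"
    using arg_cong[OF rb, of "\<lambda>u. b \<bullet> u"] vr
    unfolding wb power2_norm_eq_inner by (simp add: inner_add_left inner_add_right)
  have nb: "norm b \<le> norm (\<Phi> *v w)"
  proof (rule power2_le_imp_le)
    have "orthogonal v1 b" using bV[OF v1] by (simp add: orthogonal_def inner_commute)
    from norm_add_Pythagorean[OF this] show "(norm b)\<^sup>2 \<le> (norm (\<Phi> *v w))\<^sup>2" by (simp add: wb)
  qed simp
  have ne: "norm e2 \<le> norm e"
  proof (rule power2_le_imp_le)
    have "orthogonal e1 e2" using eV[OF e1] by (simp add: orthogonal_def inner_commute)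
    from norm_add_Pythagorean[OF this] show "(norm e2)\<^sup>2 \<le> (norm e)\<^sup>2" by (simp add: e)
  qed simp
  have wpos: "norm w > 0" using h(3) by (auto simp: supp_def)
  define \<beta> where "\<beta> = Max ((\<lambda>j. \<bar>r \<bullet> column j \<Phi>\<bar>) ` supp w)"
  have \<beta>ge: "\<bar>r \<bullet> column j \<Phi>\<bar> \<le> \<beta>" if "j \<in> supp w" for j
    using that unfolding \<beta>_def by (intro Max_ge) auto
  have \<beta>0: "0 \<le> \<beta>" using h(3) \<beta>ge abs_ge_zero order_trans by blast
  have \<beta>le: "\<beta> \<le> \<bar>r \<bullet> column i \<Phi>\<bar>" if "i \<in> h" for i
    using that h(2,3) sel[OF that] unfolding \<beta>_def by (subst Max_le_iff) auto
  have corr: "(\<Phi> *v w) \<bullet> r \<le> sqrt K * \<beta> * norm w"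
  proof -
    have "(\<Phi> *v w) \<bullet> r = (\<Sum>i\<in>supp w. w $ i * (r \<bullet> column i \<Phi>))"
      unfolding inner_matrix_vector_mult by (intro sum.mono_neutral_right) (auto simp: supp_def)
    also have "\<dots> \<le> (\<Sum>i\<in>supp w. \<bar>w $ i\<bar> * \<beta>)"
    proof (rule sum_mono)
      fix i assume "i \<in> supp w"
      have "w $ i * (r \<bullet> column i \<Phi>) \<le> \<bar>w $ i\<bar> * \<bar>r \<bullet> column i \<Phi>\<bar>"
        by (metis abs_ge_self abs_mult)
      also have "\<dots> \<le> \<bar>w $ i\<bar> * \<beta>" by (intro mult_left_mono \<beta>ge \<open>i \<in> supp w\<close>) auto
      finally show "w $ i * (r \<bullet> column i \<Phi>) \<le> \<bar>w $ i\<bar> * \<beta>" .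
    qed
    also have "\<dots> = \<beta> * (\<Sum>i\<in>supp w. \<bar>w $ i\<bar> * \<bar>1\<bar>)" by (simp add: sum_distrib_left mult.commute)
    also have "\<dots> \<le> \<beta> * (L2_set (($) w) (supp w) * L2_set (\<lambda>_. 1) (supp w))"
      by (intro mult_left_mono \<beta>0 L2_set_mult_ineq)
    also have "\<dots> = \<beta> * (norm w * sqrt (card (supp w)))"
      by (simp add: submatrix_mult_nth L2_set_def[of "\<lambda>_. 1"])
    also have "\<dots> \<le> \<beta> * (norm w * sqrt K)"
    proof -
      have "card (supp w) \<le> card (supp x)" unfolding w by (intro card_mono) (auto simp: supp_def)
      then show ?thesis using x by (intro mult_left_mono \<beta>0) auto
    qed
    finally show ?thesis by (simp add: mult_ac)
  qed
  define a where "a = (\<chi> i. if i \<in> h then r \<bullet> column i \<Phi> else 0)"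
  have sa: "supp a \<subseteq> h - \<Lambda>" using orth by (auto simp: a_def supp_def)
  have norm_a: "(norm a)\<^sup>2 = (\<Sum>i\<in>h. (r \<bullet> column i \<Phi>)\<^sup>2)"
    unfolding power2_norm_eq_inner inner_vec_def[of a a]
    by (simp add: a_def power2_eq_square if_distrib if_distribR sum.If_cases cong: if_cong)
  have aa: "(norm a)\<^sup>2 = (\<Phi> *v a) \<bullet> r"
    unfolding norm_a inner_matrix_vector_mult
    by (simp add: a_def power2_eq_square if_distrib if_distribR sum.If_cases cong: if_cong)
  have na: "norm a \<le> g * norm w + sqrt (1 + rip_const \<Phi> N) * norm e"
  proof (cases "a = 0")
    case True
    then show ?thesis using g rip_const_nonneg[OF N, of \<Phi>] by simp
  next
    case False
    have "card (supp a) \<le> N" using sa h(1) card_mono[of h "supp a"] by auto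
    then have "norm (\<Phi> *v a) \<le> sqrt (1 + rip_const \<Phi> N) * norm a"
      using N by (intro norm_mult_le_sqrt_rip_const) auto
    have "(\<Phi> *v a) \<bullet> e2 \<le> norm (\<Phi> *v a) * norm e2" by (rule norm_cauchy_schwarz)
    also have "\<dots> \<le> (sqrt (1 + rip_const \<Phi> N) * norm a) * norm e"
      using \<open>norm (\<Phi> *v a) \<le> _\<close> ne by (intro mult_mono) (simp_all add: rip_const_nonneg[OF N])
    finally have "(\<Phi> *v a) \<bullet> e2 \<le> sqrt (1 + rip_const \<Phi> N) * norm a * norm e" .
    moreover have "\<bar>(\<Phi> *v a) \<bullet> b\<bar> \<le> g * norm a * norm w"
      unfolding bz using bV[OF v1] by (intro cross sa z) (simp add: bz z inner_commute)
    ultimately have "norm a * norm a \<le> norm a * (g * norm w + sqrt (1 + rip_const \<Phi> N) * norm e)"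
      using aa by (simp add: rb inner_add_right power2_eq_square algebra_simps)
    then show ?thesis using False by simp
  qed
  show thesis
  proof (rule that[of \<beta>])
    have "N * \<beta>\<^sup>2 \<le> (\<Sum>i\<in>h. (r \<bullet> column i \<Phi>)\<^sup>2)"
    proof -
      have "(\<Sum>i\<in>h. \<beta>\<^sup>2) \<le> (\<Sum>i\<in>h. (r \<bullet> column i \<Phi>)\<^sup>2)"
        using \<beta>0 \<beta>le by (intro sum_mono) (simp flip: abs_le_square_iff)
      then show ?thesis by (simp add: h)
    qed
    also have "\<dots> = (norm a)\<^sup>2"
      by (simp add: norm_a)
    finally have "sqrt N * \<beta> \<le> norm a"
      using power2_le_imp_le[of "sqrt N * \<beta>" "norm a"] by (simp add: power_mult_distrib)
    with na show "sqrt N * \<beta> \<le> g * norm w + sqrt (1 + rip_const \<Phi> N) * norm e" by simp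
    have "card (supp w) \<le> K" using x card_mono[of "supp x" "supp w"] by (auto simp: w supp_restrict_vec)
    then have "norm b \<le> sqrt (1 + rip_const \<Phi> K) * norm w"
      using nb norm_mult_le_sqrt_rip_const[OF K] order_trans by blast
    then have "norm b * norm e2 \<le> (sqrt (1 + rip_const \<Phi> K) * norm w) * norm e"
      using ne by (intro mult_mono) (simp_all add: rip_const_nonneg[OF K])
    moreover have "\<bar>b \<bullet> e2\<bar> \<le> norm b * norm e2" by (rule Cauchy_Schwarz_ineq2)
    moreover have "l * (norm w)\<^sup>2 \<le> (norm b)\<^sup>2" unfolding bz by (rule lower[OF z(2)])
    ultimately have "norm w * (l * norm w)
        \<le> norm w * (sqrt K * \<beta> + sqrt (1 + rip_const \<Phi> K) * norm e)"
      using corr wr by (simp add: power2_eq_square algebra_simps)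
    then show "l * norm w \<le> sqrt K * \<beta> + sqrt (1 + rip_const \<Phi> K) * norm e" using wpos by simp
    have "e \<bullet> r \<le> norm r * norm e" using norm_cauchy_schwarz[of e r] by (simp add: mult.commute)
    then show "(norm r)\<^sup>2 \<le> sqrt K * \<beta> * norm w + norm r * norm e"
      using rw corr by (simp add: power2_norm_eq_inner)
  qed
qed

section \<open>Bounding the residual\<close>

lemma residual_bound_from_inequalities:
  fixes a b p q g l t \<beta> u E B t0 :: real
  assumes pos: "0 < a" "0 < b" "0 \<le> p" "0 \<le> q" "0 \<le> g" "0 \<le> t" "0 < E" "0 < B"
    and i: "a * \<beta> \<le> g * t + q * E"
    and ii: "l * t \<le> b * \<beta> + p * E"
    and iii: "u\<^sup>2 \<le> b * \<beta> * t + u * E"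
    and den: "0 < a * l - b * g" and t0: "t0 * (a * l - b * g) = (a * p + b * q) * E"
    and B: "l * t0\<^sup>2 \<le> B\<^sup>2"
  shows "u < B + E"
proof (rule ccontr)
  assume "\<not> u < B + E"
  then have u: "B + E \<le> u" by simp
  have "a * (l * t) \<le> a * (b * \<beta> + p * E)" using ii pos by (intro mult_left_mono) auto
  moreover have ib: "b * (a * \<beta>) \<le> b * (g * t + q * E)" using i pos by (intro mult_left_mono) auto
  ultimately have "t * (a * l - b * g) \<le> t0 * (a * l - b * g)"
    unfolding t0 by (simp add: algebra_simps)
  then have t: "t \<le> t0" using den by simp
  have "t * (b * (g * t + q * E)) \<le> t0 * (b * (g * t0 + q * E))"
    using t pos by (intro mult_mono add_mono mult_nonneg_nonneg add_nonneg_nonneg) auto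
  also have "\<dots> = t0 * (a * l * t0 - a * p * E)"
  proof -
    have "b * (g * t0 + q * E) = a * l * t0 - a * p * E" using t0 by (simp add: algebra_simps)
    then show ?thesis by simp
  qed
  finally have "t * (b * (a * \<beta>)) \<le> t0 * (a * l * t0 - a * p * E)"
    using mult_left_mono[OF ib \<open>0 \<le> t\<close>] by linarith
  then have "a * (b * \<beta> * t) \<le> a * (l * t0\<^sup>2 - p * t0 * E)"
    by (simp add: algebra_simps power2_eq_square)
  then have "b * \<beta> * t \<le> l * t0\<^sup>2 - p * t0 * E" using pos by simp
  moreover have "0 \<le> p * t0 * E" using pos t by (intro mult_nonneg_nonneg) auto
  ultimately have "u\<^sup>2 - u * E \<le> B\<^sup>2" using iii B by linarith
  moreover have "(B + E) * B \<le> u * (u - E)" using u pos by (intro mult_mono) auto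
  moreover have "0 < E * B" using pos by simp
  ultimately show False by (simp add: algebra_simps power2_eq_square)
qed

lemma generic_step_constant:
  fixes a b p q \<delta> E :: real
  assumes pos: "0 < a" "0 < b" "1 \<le> p" "1 \<le> q" "0 < E" "0 \<le> \<delta>"
    and D: "0 < a - (b + 2 * a) * \<delta>"
  defines "A \<equiv> (1 - \<delta>) * (a * p + b * q) / (a - (b + 2 * a) * \<delta>)"
    and "c \<equiv> a * (1 - \<delta>) - b * (\<delta> / (1 - \<delta>))"
  shows "0 < c" and "(1 - \<delta>) * ((a * p + b * q) * E / c)\<^sup>2 \<le> (p * A * E)\<^sup>2"
proof -
  have "0 \<le> b * \<delta>" using pos by simp
  then have "a * (2 * \<delta>) < a * 1" using D by (simp add: algebra_simps)
  then have \<delta>: "\<delta> < 1/2" using pos by simp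
  have "(1 - \<delta>) * c = a * (1 - \<delta>)\<^sup>2 - b * \<delta>"
    using \<delta> by (simp add: c_def power2_eq_square field_simps)
  also have "\<dots> = a - (b + 2 * a) * \<delta> + a * \<delta>\<^sup>2"
    by (simp add: algebra_simps power2_eq_square)
  also have "\<dots> \<ge> a - (b + 2 * a) * \<delta>" using pos by simp
  finally have c: "a - (b + 2 * a) * \<delta> \<le> (1 - \<delta>) * c" .
  then have "0 < (1 - \<delta>) * c" using D by linarith
  then show c0: "0 < c" using \<delta> by (simp add: zero_less_mult_iff)
  have S: "0 < a * p + b * q" using pos by (intro add_pos_pos mult_pos_pos) auto
  have "(a * p + b * q) * E / c = (1 - \<delta>) * (a * p + b * q) * E / ((1 - \<delta>) * c)" using \<delta> by simp
  also have "\<dots> \<le> (1 - \<delta>) * (a * p + b * q) * E / (a - (b + 2 * a) * \<delta>)"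
    using c D S \<delta> pos by (intro divide_left_mono) auto
  also have "\<dots> = A * E" by (simp add: A_def)
  finally have t0: "(a * p + b * q) * E / c \<le> A * E" .
  moreover have t0': "0 \<le> (a * p + b * q) * E / c" using S c0 pos by simp
  moreover have "A * E \<le> p * (A * E)"
    using t0 t0' mult_right_mono[of 1 p "A * E"] pos by simp
  ultimately have "((a * p + b * q) * E / c)\<^sup>2 \<le> (p * A * E)\<^sup>2"
    by (intro power_mono) (auto simp: mult.assoc)
  then show "(1 - \<delta>) * ((a * p + b * q) * E / c)\<^sup>2 \<le> (p * A * E)\<^sup>2"
    using \<delta> pos mult_right_mono[of "1 - \<delta>" 1 "((a * p + b * q) * E / c)\<^sup>2"] by simp
qed

text \<open>In the first iteration \<open>w = x\<close> has the lower isometry bound \<open>1 - \<eta>\<close> with the constant \<open>\<eta>\<close> of order \<open>K\<close>;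
  this, together with \<open>p\<^sup>2 = 1 + \<eta>\<close>, compensates the factor \<open>\<gamma> > 1\<close>.\<close>

lemma first_step_constant:
  fixes a b q \<gamma> \<delta> \<eta> E :: real
  assumes pos: "0 < a" "0 < b" "1 \<le> q" "0 < E" "0 \<le> \<eta>" "\<eta> \<le> \<delta>" "0 \<le> \<gamma>"
    and D: "0 < a - (b + 2 * a) * \<delta>"
    and \<gamma>: "b * \<gamma> \<le> b + a * (1 - \<delta>)"
  defines "p \<equiv> sqrt (1 + \<eta>)"
  defines "A \<equiv> (1 - \<delta>) * (a * p + b * q) / (a - (b + 2 * a) * \<delta>)"
    and "c \<equiv> a * (1 - \<eta>) - b * (\<gamma> * \<delta>)"
  shows "0 < c" and "(1 - \<eta>) * ((a * p + b * q) * E / c)\<^sup>2 \<le> (p * A * E)\<^sup>2"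
proof -
  let ?D = "a - (b + 2 * a) * \<delta>"
  have \<delta>0: "0 \<le> \<delta>" using pos by simp
  have "0 \<le> b * \<delta>" using pos by simp
  then have "a * (2 * \<delta>) < a * 1" using D by (simp add: algebra_simps)
  then have \<delta>: "\<delta> < 1/2" using pos by simp
  have p: "p\<^sup>2 = 1 + \<eta>" "0 < p" using pos by (simp_all add: p_def)
  have "(1 - \<delta>\<^sup>2) * (?D + a * \<delta>\<^sup>2) - ?D = \<delta>\<^sup>2 * (b * \<delta> + 2 * (a * \<delta>) - a * \<delta> * \<delta>)"
    by (simp add: algebra_simps power2_eq_square)
  moreover have "a * \<delta> * \<delta> \<le> a * \<delta> * 1" using \<delta> \<delta>0 pos by (intro mult_left_mono) auto
  then have "0 \<le> \<delta>\<^sup>2 * (b * \<delta> + 2 * (a * \<delta>) - a * \<delta> * \<delta>)"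
    using \<open>0 \<le> b * \<delta>\<close> \<delta>0 pos mult_nonneg_nonneg[of a \<delta>]
    by (intro mult_nonneg_nonneg zero_le_power2) linarith
  ultimately have "?D \<le> (1 - \<delta>\<^sup>2) * (?D + a * \<delta>\<^sup>2)" by linarith
  also have "\<dots> \<le> (1 - \<delta>\<^sup>2) * (a * (1 - \<delta>) - b * \<gamma> * \<delta>)"
  proof (rule mult_left_mono)
    have "b * \<gamma> * \<delta> \<le> (b + a * (1 - \<delta>)) * \<delta>" using \<gamma> \<delta>0 by (intro mult_right_mono)
    then show "?D + a * \<delta>\<^sup>2 \<le> a * (1 - \<delta>) - b * \<gamma> * \<delta>"
      by (simp add: algebra_simps power2_eq_square)
    show "0 \<le> 1 - \<delta>\<^sup>2" using \<delta> \<delta>0 by (simp add: abs_square_le_1)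
  qed
  also have "\<dots> = (1 - \<delta>) * (a * (1 - \<delta>\<^sup>2) - b * \<gamma> * \<delta> * (1 + \<delta>))"
    by (simp add: algebra_simps power2_eq_square)
  also have "\<dots> \<le> (1 - \<delta>) * (a * (1 - \<eta>\<^sup>2) - b * \<gamma> * \<delta> * (1 + \<eta>))"
    using pos \<delta> \<delta>0 by (intro mult_left_mono diff_mono power_mono) auto
  also have "\<dots> = (1 + \<eta>) * (1 - \<delta>) * c"
    by (simp add: c_def algebra_simps power2_eq_square)
  finally have c: "?D \<le> (1 + \<eta>) * (1 - \<delta>) * c" .
  then have "0 < (1 + \<eta>) * (1 - \<delta>) * c" using D by linarith
  moreover have "0 < (1 + \<eta>) * (1 - \<delta>)" using \<delta> pos by simp
  ultimately show c0: "0 < c" using zero_less_mult_pos by blast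
  let ?t = "(a * p + b * q) * E / c"
  have S: "0 < a * p + b * q" using pos p by (intro add_pos_pos mult_pos_pos) auto
  have "?t = (1 + \<eta>) * ((1 - \<delta>) * (a * p + b * q) * E) / ((1 + \<eta>) * (1 - \<delta>) * c)"
    using \<delta> pos by simp
  also have "\<dots> \<le> (1 + \<eta>) * ((1 - \<delta>) * (a * p + b * q) * E) / ?D"
    using c D S \<delta> pos by (intro divide_left_mono) auto
  also have "\<dots> = (1 + \<eta>) * (A * E)" by (simp add: A_def)
  finally have t: "?t \<le> (1 + \<eta>) * (A * E)" .
  have "0 \<le> ?t" using S c0 pos by simp
  then have "?t\<^sup>2 \<le> ((1 + \<eta>) * (A * E))\<^sup>2" using t by (intro power_mono)
  then have "(1 - \<eta>) * ?t\<^sup>2 \<le> (1 - \<eta>) * ((1 + \<eta>) * (A * E))\<^sup>2"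
    using \<delta> pos by (intro mult_left_mono) auto
  also have "\<dots> = (1 - \<eta>\<^sup>2) * ((1 + \<eta>) * (A * E)\<^sup>2)"
    by (simp add: power_mult_distrib) (simp add: algebra_simps power2_eq_square)
  also have "\<dots> \<le> 1 * ((1 + \<eta>) * (A * E)\<^sup>2)" using pos by (intro mult_right_mono) auto
  also have "\<dots> = (p * A * E)\<^sup>2" by (simp add: p power_mult_distrib)
  finally show "(1 - \<eta>) * ?t\<^sup>2 \<le> (p * A * E)\<^sup>2" .
qed

lemma single_atom_constant:
  fixes N K :: nat and \<delta> :: real
  assumes NK: "N = 1 \<and> 2 \<le> K \<or> K = 1 \<and> 2 \<le> N"
    and \<delta>: "\<delta> < sqrt N / (sqrt K + 2 * sqrt N)"
  shows "sqrt K * sqrt (real (N * K) / (real (N * K) - 1)) \<le> sqrt K + sqrt N * (1 - \<delta>)"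
  using NK
proof
  assume *: "N = 1 \<and> 2 \<le> K"
  then have K: "2 \<le> real K" by simp
  have s: "1.4 \<le> sqrt K" using K by (intro real_le_rsqrt) (simp add: power2_eq_square)
  have "\<delta> \<le> 0.3"
  proof -
    have "\<delta> < 1 / (sqrt K + 2)" using \<delta> * by simp
    also have "\<dots> \<le> 0.3" using s by (simp add: field_simps)
    finally show ?thesis by simp
  qed
  have "sqrt K * sqrt (real K / (real K - 1)) \<le> sqrt K + 0.7"
  proof (rule power2_le_imp_le)
    have "(sqrt K * sqrt (real K / (real K - 1)))\<^sup>2 = real K * real K / (real K - 1)"
      using K by (simp add: power_mult_distrib)
    also have "\<dots> \<le> real K + 2" using K by (simp add: field_simps)
    also have "\<dots> \<le> real K + 1.4 * sqrt K + 0.49" using s by simp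
    also have "\<dots> = (sqrt K + 0.7)\<^sup>2" by (simp add: power2_eq_square algebra_simps)
    finally show "(sqrt K * sqrt (real K / (real K - 1)))\<^sup>2 \<le> (sqrt K + 0.7)\<^sup>2" .
  qed simp
  with * \<open>\<delta> \<le> 0.3\<close> show ?thesis by simp
next
  assume *: "K = 1 \<and> 2 \<le> N"
  then have N: "2 \<le> real N" by simp
  have s: "1.4 \<le> sqrt N" using N by (intro real_le_rsqrt) (simp add: power2_eq_square)
  have "\<delta> \<le> 0.5"
  proof -
    have "\<delta> < sqrt N / (1 + 2 * sqrt N)" using \<delta> * by simp
    also have "\<dots> \<le> 0.5" using s by (simp add: field_simps)
    finally show ?thesis by simp
  qed
  then have "1.4 * 0.5 \<le> sqrt N * (1 - \<delta>)" using s by (intro mult_mono) auto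
  moreover have "sqrt (real N / (real N - 1)) \<le> 1.5"
  proof (rule real_le_lsqrt)
    show "real N / (real N - 1) \<le> 1.5\<^sup>2" using N by (simp add: field_simps power2_eq_square)
  qed (use N in auto)
  ultimately show ?thesis using * by simp
qed

lemma residual_after_failed_selection:
  fixes \<Phi> :: "real ^ 'n ^ 'm" and x y :: "real ^ 'n" and e r :: "real ^ 'm"
  assumes N: "1 \<le> N" and K: "1 \<le> K" and NK: "\<not> (N = 1 \<and> K = 1)" and k: "k < K"
    and x: "card (supp x) \<le> K" and e: "e \<noteq> 0"
    and \<Lambda>: "card \<Lambda> \<le> N * k" "k \<le> card (supp x \<inter> \<Lambda>)"
    and \<delta>: "\<delta> = rip_const \<Phi> (N * K)" "\<delta> < sqrt N / (sqrt K + 2 * sqrt N)"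
    and r: "r = \<Phi> *v x + e - \<Phi> *v y" "supp y \<subseteq> \<Lambda>"
    and orth: "\<And>j. j \<in> \<Lambda> \<Longrightarrow> r \<bullet> column j \<Phi> = 0"
    and h: "card h = N" "h \<inter> (supp x - \<Lambda>) = {}" "\<not> supp x \<subseteq> \<Lambda>"
    and sel: "\<And>i j. i \<in> h \<Longrightarrow> j \<notin> h \<Longrightarrow> \<bar>r \<bullet> column j \<Phi>\<bar> \<le> \<bar>r \<bullet> column i \<Phi>\<bar>"
    and p: "p = sqrt (1 + rip_const \<Phi> K)" and q: "q = sqrt (1 + rip_const \<Phi> N)"
  shows "norm r < p * ((1 - \<delta>) * (sqrt N * p + sqrt K * q) / (sqrt N - (sqrt K + 2 * sqrt N) * \<delta>)) * norm e
    + norm e"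
proof -
  define w where "w = restrict_vec x (- \<Lambda>)"
  define A where "A = (1 - \<delta>) * (sqrt N * p + sqrt K * q) / (sqrt N - (sqrt K + 2 * sqrt N) * \<delta>)"
  have sw: "supp w = supp x - \<Lambda>" by (auto simp: w_def supp_restrict_vec)
  have hw: "h \<inter> supp w = {}" "supp w \<noteq> {}" using h by (auto simp: sw)
  have cw: "card (supp w) + k \<le> K"
    using card_Int_Diff[of "supp x" \<Lambda>] x \<Lambda>(2) by (simp add: sw)
  have NK1: "1 \<le> N * K" using N K by simp
  have KNK: "K \<le> N * K" using N by simp
  have \<delta>0: "0 \<le> \<delta>" unfolding \<delta>(1) by (rule rip_const_nonneg[OF NK1])
  have \<eta>0: "0 \<le> rip_const \<Phi> K" "0 \<le> rip_const \<Phi> N"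
    using rip_const_nonneg[OF K] rip_const_nonneg[OF N] by auto
  have \<eta>\<delta>: "rip_const \<Phi> K \<le> \<delta>" unfolding \<delta>(1) by (rule rip_const_mono[OF K KNK])
  have pq: "1 \<le> p" "1 \<le> q" using \<eta>0 by (simp_all add: p q)
  have ab: "0 < sqrt N" "0 < sqrt K" using N K by auto
  have E: "0 < norm e" using e by simp
  have D: "0 < sqrt N - (sqrt K + 2 * sqrt N) * \<delta>"
    using \<delta>(2) ab by (simp add: pos_less_divide_eq add_pos_pos mult.commute)
  have "0 \<le> sqrt K * \<delta>" using \<delta>0 by simp
  then have "sqrt N * (2 * \<delta>) < sqrt N * 1" using D by (simp add: algebra_simps)
  then have \<delta>1: "\<delta> < 1/2" using ab by simp
  have S: "0 < sqrt N * p + sqrt K * q" using ab pq by (intro add_pos_pos mult_pos_pos) auto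
  have B: "0 < p * A * norm e"
    unfolding A_def using pq \<delta>1 S D E by (intro mult_pos_pos divide_pos_pos) auto
  have "norm r < p * A * norm e + norm e"
  proof (cases "1 \<le> k \<or> 2 \<le> N \<and> 2 \<le> K")
    case True
    obtain m where m: "K = k + m" "1 \<le> m" using k by (metis less_imp_add_positive less_eq_Suc_le One_nat_def)
    have card1: "N * k + m \<le> N * K" using N by (simp add: m algebra_simps)
    have card2: "N * k + N \<le> N * K" using m by (simp add: algebra_simps)
    have card3: "N + m \<le> N * K"
    proof (cases "1 \<le> k")
      case True
      then have "N * 1 \<le> N * k" by (intro mult_le_mono2)
      moreover have "1 * m \<le> N * m" using N by (intro mult_le_mono1)
      ultimately show ?thesis unfolding m(1) distrib_left by linarith
    next
      case False
      with True m have "2 \<le> N" "2 \<le> m" "K = m" by auto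
      then obtain i j where "N = 2 + i" "m = 2 + j" using le_Suc_ex by meson
      then show ?thesis using \<open>K = m\<close> by (simp add: algebra_simps)
    qed
    have cwm: "card (supp w) \<le> m" using cw m by simp
    let ?g = "\<delta> / (1 - \<delta>)"
    have g0: "0 \<le> ?g" using \<delta>0 \<delta>1 by simp
    have cardU: "card (supp z \<union> supp w) \<le> N * K" if "supp z \<subseteq> \<Lambda>" for z
      using card_Un_le[of "supp z" "supp w"] card_mono[OF finite that] \<Lambda>(1) cwm card1 by linarith
    have disj: "supp z \<inter> supp w = {}" if "supp z \<subseteq> \<Lambda>" for z using that by (auto simp: sw)
    have lower: "(1 - \<delta>) * (norm w)\<^sup>2 \<le> (norm (\<Phi> *v (w - z)))\<^sup>2" if z: "supp z \<subseteq> \<Lambda>" for z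
    proof -
      have "card (supp (w - z)) \<le> N * K"
        using card_mono[OF finite supp_diff[of w z]] cardU[OF z] by (simp add: Un_commute)
      then have "(1 - \<delta>) * (norm (w - z))\<^sup>2 \<le> (norm (\<Phi> *v (w - z)))\<^sup>2"
        unfolding \<delta>(1) by (rule rip_const_bounds(1)[OF NK1])
      moreover have "(norm (w - z))\<^sup>2 = (norm w)\<^sup>2 + (norm z)\<^sup>2"
        using disj[OF z] by (intro norm_disjoint_supp) blast
      then have "(1 - \<delta>) * (norm w)\<^sup>2 \<le> (1 - \<delta>) * (norm (w - z))\<^sup>2"
        using \<delta>1 by (intro mult_left_mono) auto
      ultimately show ?thesis by linarith
    qed
    have cross: "\<bar>(\<Phi> *v a) \<bullet> (\<Phi> *v (w - z))\<bar> \<le> ?g * norm a * norm w"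
      if a: "supp a \<subseteq> h - \<Lambda>" and z: "supp z \<subseteq> \<Lambda>" and o: "(\<Phi> *v z) \<bullet> (\<Phi> *v (w - z)) = 0" for a z
    proof -
      have ca: "card (supp a) \<le> N" using card_mono[of h "supp a"] a h(1) by auto
      have aw: "\<bar>(\<Phi> *v a) \<bullet> (\<Phi> *v w)\<bar> \<le> \<delta> * norm a * norm w"
        unfolding \<delta>(1)
      proof (rule rip_inner_disjoint[OF NK1])
        show "supp a \<inter> supp w = {}" using a hw by blast
        show "card (supp a \<union> supp w) \<le> N * K"
          using card_Un_le[of "supp a" "supp w"] ca cwm card3 by linarith
      qed
      have az: "\<bar>(\<Phi> *v a) \<bullet> (\<Phi> *v z)\<bar> \<le> \<delta> * norm a * norm z"
        unfolding \<delta>(1)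
      proof (rule rip_inner_disjoint[OF NK1])
        show "supp a \<inter> supp z = {}" using a z by blast
        show "card (supp a \<union> supp z) \<le> N * K"
          using card_Un_le[of "supp a" "supp z"] ca card_mono[OF finite z] \<Lambda>(1) card2 by linarith
      qed
      have zw: "\<bar>(\<Phi> *v z) \<bullet> (\<Phi> *v w)\<bar> \<le> \<delta> * norm z * norm w"
        unfolding \<delta>(1) by (intro rip_inner_disjoint[OF NK1] disj cardU z)
      have "card (supp z) \<le> N * K" using card_mono[OF finite z] \<Lambda>(1) card1 by linarith
      then have "(1 - \<delta>) * (norm z)\<^sup>2 \<le> (norm (\<Phi> *v z))\<^sup>2"
        unfolding \<delta>(1) by (rule rip_const_bounds(1)[OF NK1])
      also have "\<dots> = (\<Phi> *v z) \<bullet> (\<Phi> *v w)"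
        using o by (simp add: matrix_vector_mult_diff_distrib inner_diff_right power2_norm_eq_inner)
      finally have "norm z * ((1 - \<delta>) * norm z) \<le> norm z * (\<delta> * norm w)"
        using zw by (simp add: power2_eq_square mult_ac)
      then have "(1 - \<delta>) * norm z \<le> \<delta> * norm w" using \<delta>0 by (cases "z = 0") auto
      then have nz: "norm z \<le> ?g * norm w" using \<delta>1 by (simp add: field_simps)
      have "\<bar>(\<Phi> *v a) \<bullet> (\<Phi> *v (w - z))\<bar> \<le> \<delta> * norm a * norm w + \<delta> * norm a * norm z"
        using aw az by (simp add: matrix_vector_mult_diff_distrib inner_diff_right)
      also have "\<dots> \<le> \<delta> * norm a * norm w + \<delta> * norm a * (?g * norm w)"
        using nz \<delta>0 by (intro add_left_mono mult_left_mono) auto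
      also have "\<dots> = (\<delta> + \<delta> * ?g) * norm a * norm w" by (simp add: algebra_simps)
      also have "\<delta> + \<delta> * ?g = ?g" using \<delta>1 by (simp add: field_simps)
      finally show ?thesis .
    qed
    obtain \<beta> where \<beta>: "sqrt N * \<beta> \<le> ?g * norm w + q * norm e"
      "(1 - \<delta>) * norm w \<le> sqrt K * \<beta> + p * norm e"
      "(norm r)\<^sup>2 \<le> sqrt K * \<beta> * norm w + norm r * norm e"
      by (rule failed_selection_inequalities[OF N K x w_def r orth h(1) hw sel g0 lower cross,
            folded p q])
    note const = generic_step_constant[OF ab pq E \<delta>0 D, folded A_def]
    show ?thesis
      by (rule residual_bound_from_inequalities[OF ab _ _ g0 norm_ge_zero E B \<beta> const(1) _ const(2)])
        (use pq const(1) in auto)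
  next
    case False
    then have k0: "k = 0" and NK': "N = 1 \<and> 2 \<le> K \<or> K = 1 \<and> 2 \<le> N"
      using NK N K by auto
    have \<Lambda>0: "\<Lambda> = {}" using \<Lambda>(1) k0 by simp
    have cwK: "card (supp w) \<le> K" using cw by simp
    have M: "2 \<le> N * K" using NK' by auto
    define \<gamma> where "\<gamma> = sqrt (real (N * K) / (real (N * K) - 1))"
    have \<gamma>0: "0 \<le> \<gamma>" using M unfolding \<gamma>_def by (intro real_sqrt_ge_zero divide_nonneg_nonneg) linarith+
    have g0: "0 \<le> \<gamma> * \<delta>" using \<gamma>0 \<delta>0 by simp
    have z0: "z = 0" if "supp z \<subseteq> \<Lambda>" for z using that by (auto simp: \<Lambda>0 supp_def vec_eq_iff)
    have lower: "(1 - rip_const \<Phi> K) * (norm w)\<^sup>2 \<le> (norm (\<Phi> *v (w - z)))\<^sup>2" if z: "supp z \<subseteq> \<Lambda>" for z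
      using rip_const_bounds(1)[OF K cwK] by (simp add: z0[OF z])
    have cross: "\<bar>(\<Phi> *v a) \<bullet> (\<Phi> *v (w - z))\<bar> \<le> \<gamma> * \<delta> * norm a * norm w"
      if a: "supp a \<subseteq> h - \<Lambda>" and z: "supp z \<subseteq> \<Lambda>" for a z
    proof -
      have ca: "card (supp a) \<le> N" using card_mono[of h "supp a"] a h(1) by auto
      have disj: "supp a \<inter> supp w = {}" using a hw by blast
      from NK' have "\<bar>(\<Phi> *v a) \<bullet> (\<Phi> *v w)\<bar> \<le> \<gamma> * \<delta> * norm a * norm w"
      proof
        assume "N = 1 \<and> 2 \<le> K"
        then show ?thesis
          using rip_inner_single[OF M _ _ disj, of \<Phi>] ca cwK by (simp add: \<gamma>_def \<delta>(1))
      next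
        assume "K = 1 \<and> 2 \<le> N"
        then show ?thesis
          using rip_inner_single[OF M, of w a \<Phi>] disj ca cwK
          by (simp add: \<gamma>_def \<delta>(1) inner_commute Int_commute mult_ac)
      qed
      then show ?thesis by (simp add: z0[OF z])
    qed
    obtain \<beta> where \<beta>: "sqrt N * \<beta> \<le> \<gamma> * \<delta> * norm w + q * norm e"
      "(1 - rip_const \<Phi> K) * norm w \<le> sqrt K * \<beta> + p * norm e"
      "(norm r)\<^sup>2 \<le> sqrt K * \<beta> * norm w + norm r * norm e"
      by (rule failed_selection_inequalities[OF N K x w_def r orth h(1) hw sel g0 lower cross,
            folded p q])
    have "sqrt K * \<gamma> \<le> sqrt K + sqrt N * (1 - \<delta>)"
      unfolding \<gamma>_def by (rule single_atom_constant[OF NK' \<delta>(2)])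
    note const = first_step_constant[OF ab pq(2) E \<eta>0(1) \<eta>\<delta> \<gamma>0 D this, folded p, folded A_def]
    show ?thesis
      by (rule residual_bound_from_inequalities[OF ab _ _ g0 norm_ge_zero E B \<beta> const(1) _ const(2)])
        (use pq const(1) in auto)
  qed
  then show ?thesis by (simp add: A_def)
qed

section \<open>The recovery error\<close>

lemma least_squares_residual_orthogonal:
  fixes \<Phi> :: "real ^ 'n ^ 'm"
  assumes min: "is_arg_min (\<lambda>z. norm (v - \<Phi> *v z)) (\<lambda>z. supp z \<subseteq> S) X" and j: "j \<in> S"
  shows "(v - \<Phi> *v X) \<bullet> column j \<Phi> = 0"
proof (cases "column j \<Phi> = 0")
  case False
  define r c where "r = v - \<Phi> *v X" and "c = column j \<Phi>"
  define s where "s = (r \<bullet> c) / (c \<bullet> c)"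
  have cc: "0 < c \<bullet> c" using False by (simp add: c_def)
  have "supp (X + s *\<^sub>R axis j 1) \<subseteq> S"
    using min j by (auto simp: is_arg_min_linorder supp_def axis_def split: if_splits)
  then have "norm r \<le> norm (v - \<Phi> *v (X + s *\<^sub>R axis j 1))"
    using min unfolding is_arg_min_linorder r_def by blast
  also have "v - \<Phi> *v (X + s *\<^sub>R axis j 1) = r - s *\<^sub>R c"
    by (simp add: r_def c_def matrix_vector_right_distrib matrix_vector_mult_scaleR
        matrix_vector_mult_basis algebra_simps)
  finally have "(norm r)\<^sup>2 \<le> (norm (r - s *\<^sub>R c))\<^sup>2" by (intro power_mono) auto
  also have "\<dots> = (norm r)\<^sup>2 - 2 * s * (r \<bullet> c) + s * (s * (c \<bullet> c))"
    by (simp add: power2_norm_eq_inner inner_diff_left inner_diff_right inner_commute[of c r]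
        algebra_simps)
  also have "s * (c \<bullet> c) = r \<bullet> c" using cc by (simp add: s_def)
  finally have "s * (r \<bullet> c) \<le> 0" by simp
  then have "(r \<bullet> c) * (r \<bullet> c) \<le> 0" using cc by (simp add: s_def divide_le_0_iff)
  then have "r \<bullet> c = 0"
    using zero_le_square[of "r \<bullet> c"] by (metis mult_eq_0_iff order_antisym)
  then show ?thesis by (simp add: r_def c_def)
qed simp

lemma gomp_error_const_eq:
  "gomp_error_const \<Phi> N K =
     (sqrt (1 + rip_const \<Phi> K) * ((1 - rip_const \<Phi> (N * K)) *
       (sqrt N * sqrt (1 + rip_const \<Phi> K) + sqrt K * sqrt (1 + rip_const \<Phi> N)) /
       (sqrt N - (sqrt K + 2 * sqrt N) * rip_const \<Phi> (N * K))) + 2) / sqrt (1 - rip_const \<Phi> (N * K + K))"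
  if "0 \<le> rip_const \<Phi> K"
proof -
  have "sqrt (1 + rip_const \<Phi> K) * (sqrt N * sqrt (1 + rip_const \<Phi> K) + sqrt K * sqrt (1 + rip_const \<Phi> N))
    = sqrt N * (1 + rip_const \<Phi> K) + sqrt (K * (1 + rip_const \<Phi> N) * (1 + rip_const \<Phi> K))"
  proof -
    have "sqrt N * (1 + rip_const \<Phi> K)
      = sqrt N * (sqrt (1 + rip_const \<Phi> K) * sqrt (1 + rip_const \<Phi> K))"
      using that by simp
    then show ?thesis unfolding real_sqrt_mult by (simp only: algebra_simps)
  qed
  from this[symmetric] show ?thesis
    unfolding gomp_error_const_def by (simp only:) (simp add: add_divide_distrib mult.left_commute)
qed

theorem theorem3:
  fixes \<Phi> :: "real ^ 'n ^ 'm" and x :: "real ^ 'n" and e :: "real ^ 'm"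
    and N K :: nat
    and h \<Lambda> :: "nat \<Rightarrow> 'n set" and X :: "nat \<Rightarrow> real ^ 'n" and r :: "nat \<Rightarrow> real ^ 'm"
  assumes "K \<ge> 1" and "N \<ge> 1"
    and "\<not> (N = 1 \<and> K = 1)"
    and "N * K < CARD('m)"
    and "k_sparse K x"
    and "e \<noteq> 0"
    and "gomp_run \<Phi> (\<Phi> *v x + e) N K h \<Lambda> X r"
    and "\<forall>k\<in>{1..K}. full_column_rank \<Phi> (\<Lambda> k)"
    and "rip_const \<Phi> (N * K + K) < 1"
    and "rip_const \<Phi> (N * K) < sqrt N / (sqrt K + 2 * sqrt N)"
  shows "norm (x - X K) < gomp_error_const \<Phi> N K * norm e"
proof -
  define v where "v = \<Phi> *v x + e"
  define T where "T = supp x"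
  define Y where "Y k = (if k = 0 then 0 else X k)" for k
  note K = assms(1) and N = assms(2)
  have x: "card T \<le> K" using assms(5) by (simp add: k_sparse_def T_def)
  have run0: "r 0 = v" "\<Lambda> 0 = {}" using assms(7) by (simp_all add: gomp_run_def v_def)
  have run: "card (h k) = N"
    "\<And>i j. i \<in> h k \<Longrightarrow> j \<notin> h k \<Longrightarrow> \<bar>r (k - 1) \<bullet> column j \<Phi>\<bar> \<le> \<bar>r (k - 1) \<bullet> column i \<Phi>\<bar>"
    "\<Lambda> k = \<Lambda> (k - 1) \<union> h k"
    "is_arg_min (\<lambda>z. norm (v - \<Phi> *v z)) (\<lambda>z. supp z \<subseteq> \<Lambda> k) (X k)"
    "r k = v - \<Phi> *v X k"
    if "k \<in> {1..K}" for k
    using assms(7)[unfolded gomp_run_def, folded v_def] that by blast+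
  have step: "card (h (Suc k)) = N" "\<Lambda> (Suc k) = \<Lambda> k \<union> h (Suc k)" if "k < K" for k
    using run(1,3)[of "Suc k"] that by simp_all
  have Y: "is_arg_min (\<lambda>z. norm (v - \<Phi> *v z)) (\<lambda>z. supp z \<subseteq> \<Lambda> k) (Y k)" "r k = v - \<Phi> *v Y k"
    if "k \<le> K" for k
  proof -
    have "supp z \<subseteq> {} \<longleftrightarrow> z = 0" for z :: "real ^ 'n" by (auto simp: supp_def vec_eq_iff)
    then have "is_arg_min (\<lambda>z. norm (v - \<Phi> *v z)) (\<lambda>z. supp z \<subseteq> {}) 0"
      unfolding is_arg_min_linorder by simp
    then show "is_arg_min (\<lambda>z. norm (v - \<Phi> *v z)) (\<lambda>z. supp z \<subseteq> \<Lambda> k) (Y k)"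
      using run0(2) run(4)[of k] that by (cases "k = 0") (auto simp: Y_def)
    show "r k = v - \<Phi> *v Y k" using run0(1) run(5)[of k] that by (cases "k = 0") (auto simp: Y_def)
  qed
  have suppY: "supp (Y k) \<subseteq> \<Lambda> k" if "k \<le> K" for k
    using Y(1)[OF that] by (simp add: is_arg_min_linorder)
  have Ymin: "norm (r k) \<le> norm (v - \<Phi> *v z)" if "k \<le> K" "supp z \<subseteq> \<Lambda> k" for k z
    using Y[OF that(1)] that(2) by (simp add: is_arg_min_linorder)
  have card_\<Lambda>: "card (\<Lambda> k) \<le> N * k" if "k \<le> K" for k
    using that
  proof (induction k)
    case (Suc k)
    then show ?case using card_Un_le[of "\<Lambda> k" "h (Suc k)"] step[of k] by simp
  qed (simp add: run0)
  have mono_\<Lambda>: "\<Lambda> j \<subseteq> \<Lambda> k" if "j \<le> k" "k \<le> K" for j k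
    using that by (induction k rule: dec_induct) (use step(2) in auto)
  define failed where "failed k \<longleftrightarrow> h (Suc k) \<inter> (T - \<Lambda> k) = {} \<and> \<not> T \<subseteq> \<Lambda> k \<and> k \<le> card (T \<inter> \<Lambda> k)" for k
  have progress: "T \<subseteq> \<Lambda> k \<or> k \<le> card (T \<inter> \<Lambda> k) \<or> (\<exists>j<k. failed j)" if "k \<le> K" for k
    using that
  proof (induction k)
    case (Suc k)
    then consider "T \<subseteq> \<Lambda> k" | "\<exists>j<k. failed j" | "\<not> T \<subseteq> \<Lambda> k" "k \<le> card (T \<inter> \<Lambda> k)"
      by force
    then show ?case
    proof cases
      case 3
      show ?thesis
      proof (cases "failed k")
        case False
        then obtain i where i: "i \<in> h (Suc k)" "i \<in> T" "i \<notin> \<Lambda> k" using 3 by (auto simp: failed_def)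
        then have "insert i (T \<inter> \<Lambda> k) \<subseteq> T \<inter> \<Lambda> (Suc k)" using step(2)[of k] Suc.prems by auto
        then have "card (insert i (T \<inter> \<Lambda> k)) \<le> card (T \<inter> \<Lambda> (Suc k))" by (intro card_mono) auto
        then show ?thesis using 3 i by simp
      qed auto
    qed (use mono_\<Lambda>[of k "Suc k"] Suc.prems in \<open>auto intro: less_SucI\<close>)
  qed simp
  define p q where "p = sqrt (1 + rip_const \<Phi> K)" and "q = sqrt (1 + rip_const \<Phi> N)"
  define \<delta> where "\<delta> = rip_const \<Phi> (N * K)"
  define A where "A = (1 - \<delta>) * (sqrt N * p + sqrt K * q) / (sqrt N - (sqrt K + 2 * sqrt N) * \<delta>)"
  have E: "0 < norm e" using assms(6) by simp
  have \<eta>0: "0 \<le> rip_const \<Phi> K" "0 \<le> rip_const \<Phi> N"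
    using rip_const_nonneg[OF K] rip_const_nonneg[OF N] by auto
  have ab: "0 < sqrt N" "0 < sqrt K" using N K by auto
  have D: "0 < sqrt N - (sqrt K + 2 * sqrt N) * \<delta>"
    using assms(10) ab by (simp add: pos_less_divide_eq add_pos_pos mult.commute \<delta>_def)
  have "\<delta> \<le> rip_const \<Phi> (N * K + K)" unfolding \<delta>_def using N K by (intro rip_const_mono) auto
  then have \<delta>1: "\<delta> < 1" using assms(9) by simp
  have pq: "0 < p" "0 < q" using \<eta>0 by (simp_all add: p_def q_def)
  have pA: "0 < p * A"
    unfolding A_def using ab pq \<delta>1 D by (intro mult_pos_pos divide_pos_pos add_pos_pos) auto
  have res: "norm (r K) < p * A * norm e + norm e"
  proof (cases "\<exists>k<K. failed k")
    case True
    then obtain k where k: "k < K" and fk: "failed k" by blast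
    have kK: "k \<le> K" using k by simp
    have "norm (r K) \<le> norm (r k)"
      using Ymin[of K "Y k"] Y(2)[OF kK] suppY[OF kK] mono_\<Lambda>[of k K] kK by auto
    also have "norm (r k) < p * A * norm e + norm e"
      unfolding A_def
    proof (rule residual_after_failed_selection[OF N K assms(3) k _ assms(6) card_\<Lambda>[OF kK] _ \<delta>_def _ _ suppY[OF kK]])
      show "r k = \<Phi> *v x + e - \<Phi> *v Y k" using Y(2)[OF kK] by (simp add: v_def)
      show "r k \<bullet> column j \<Phi> = 0" if "j \<in> \<Lambda> k" for j
        unfolding Y(2)[OF kK] by (rule least_squares_residual_orthogonal[OF Y(1)[OF kK] that])
      show "\<bar>r k \<bullet> column j \<Phi>\<bar> \<le> \<bar>r k \<bullet> column i \<Phi>\<bar>" if "i \<in> h (Suc k)" "j \<notin> h (Suc k)" for i j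
        using run(2)[of "Suc k" i j] k that by simp
    qed (use x fk assms(10) step(1)[OF k] in \<open>auto simp: T_def failed_def \<delta>_def p_def q_def\<close>)
    finally show ?thesis .
  next
    case False
    then have "T \<subseteq> \<Lambda> K"
      using progress[of K] x card_seteq[of T "T \<inter> \<Lambda> K"] by auto
    then have "norm (r K) \<le> norm (v - \<Phi> *v x)" by (intro Ymin) (auto simp: T_def)
    also have "\<dots> = norm e" by (simp add: v_def)
    also have "\<dots> < p * A * norm e + norm e" using pA E by simp
    finally show ?thesis .
  qed
  define \<delta>' where "\<delta>' = rip_const \<Phi> (N * K + K)"
  have \<delta>': "0 < 1 - \<delta>'" using assms(9) by (simp add: \<delta>'_def)
  have XK: "Y K = X K" using K by (simp add: Y_def)
  have "card (supp (x - X K)) \<le> N * K + K"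
  proof -
    have "supp (x - X K) \<subseteq> T \<union> \<Lambda> K" using supp_diff[of x "X K"] suppY[of K] by (auto simp: T_def XK)
    then have "card (supp (x - X K)) \<le> card (T \<union> \<Lambda> K)" by (intro card_mono) auto
    then show ?thesis using card_Un_le[of T "\<Lambda> K"] x card_\<Lambda>[of K] by linarith
  qed
  then have "(1 - \<delta>') * (norm (x - X K))\<^sup>2 \<le> (norm (\<Phi> *v (x - X K)))\<^sup>2"
    unfolding \<delta>'_def using K by (intro rip_const_bounds) auto
  then have "(sqrt (1 - \<delta>') * norm (x - X K))\<^sup>2 \<le> (norm (\<Phi> *v (x - X K)))\<^sup>2"
    using \<delta>' by (simp add: power_mult_distrib)
  then have "sqrt (1 - \<delta>') * norm (x - X K) \<le> norm (\<Phi> *v (x - X K))"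
    by (rule power2_le_imp_le) simp
  also have "\<Phi> *v (x - X K) = r K - e"
    using Y(2)[of K] by (simp add: v_def XK matrix_vector_mult_diff_distrib)
  also have "norm (r K - e) \<le> norm (r K) + norm e" by (rule norm_triangle_ineq4)
  also have "\<dots> < (p * A + 2) * norm e" using res by (simp add: algebra_simps)
  finally have "norm (x - X K) < (p * A + 2) * norm e / sqrt (1 - \<delta>')"
    using \<delta>' by (simp add: pos_less_divide_eq mult.commute)
  also have "\<dots> = gomp_error_const \<Phi> N K * norm e"
    unfolding gomp_error_const_eq[OF \<eta>0(1)] by (simp add: A_def p_def q_def \<delta>_def \<delta>'_def)
  finally show ?thesis .
qed

end
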